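(* Let $0<\sigma<p<\infty$. Fix $M\ge 1$ and let $W_\mu$ ($\mu\ge0$) be given by $W_\mu f=\sum_{A\in\mathscr A_\mu}f_A\mathbf 1_A$, where $f_A\in S$ satisfies $$\|f_A-g\|_{L^p(A)}\le M\|f-g\|_{L^p(A)}\quad\text{for all }g\in S$$ with this fixed $M$. Then for each $f\in L^p(S)$ we have $W_\mu f\to f$ in $L^p(\Omega)$ as $\mu\to\infty$. Moreover, for any $f\in L^p(S)$, $$|f|_{V_{\sigma,p}}\le\liminf_{\mu\to\infty}|W_\mu f|_{V_{\sigma,p}}\le\limsup_{\mu\to\infty}|W_\mu f|_{V_{\sigma,p}}\le\sup_{\mu\in\mathbb N}|W_\mu f|_{V_{\sigma,p}}\le M|f|_{V_{\sigma,p}}.$$ That is, if one of the values in this chain is $\infty$ then all of them are $\infty$, and if one of them is finite then all of them are finite.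
   Context: Setting. $(\Omega,\mathscr F,|\cdot|)$ is a probability space, $\nu\ge 2$ an integer, and $(\mathscr F_n)_{n\ge 0}$ a $\nu$-ary filtration: an increasing sequence of finite sub-$\sigma$-algebras of $\mathscr F$ with $\mathscr F_0=\{\emptyset,\Omega\}$, such that for each $n\ge1$ each atom of $\mathscr F_{n-1}$ is a union of at most $\nu$ atoms of $\mathscr F_n$; all atoms have positive measure. $\mathscr A_n$ is the set of atoms of $\mathscr F_n$ and $\mathscr A=\bigcup_n\mathscr A_n$. Elements of $\mathscr A$ are called atoms; nonempty differences $A\setminus B$ with $A,B\in\mathscr A$, $B\subsetneq A$, are called rings. $S$ is a finite-dimensional linear space of bounded $\mathscr F$-measurable scalar-valued functions on $\Omega$ for which there are constants $c_1,c_2\in(0,1]$ with $|\{\omega\in A:|f(\omega)|\ge c_1\|f\|_A\}|\ge c_2|A|$ for all $A\in\mathscr A$, $f\in S$, where $\|f\|_A$ is the $L^\infty$-norm of $f$ on $A$. For $R\in\mathscr F$, $S_R=\{f\mathbf 1_R:f\in S\}$. $L^p(S)$ is the closure in $L^p(\Omega)$ of the span of $\{f\mathbf 1_A:f\in S,A\in\mathscr A\}$. $E_p(f,R)=\inf\{\|f-g\|_{L^p(R)}:g\in S_R\}$ and $|f|_{V_{\sigma,p}}=\sup_\Pi\big(\sum_{R\in\Pi}E_p(f,R)^\sigma\big)^{1/\sigma}\in[0,\infty]$, the supremum being over all finite collections $\Pi$ of pairwise disjoint atoms or rings. The choice of $f_A$ (for each $f$ and $A$) need not be unique, $W_\mu$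 need not be linear, and for given $M$ it is understood that such $f_A$ have been chosen (they exist for every $f$ and $A$ if $M\ge 2^{1/\min(1,p)}$). *)

theory Defs
  imports "HOL-Probability.Probability" "HOL-Library.Function_Algebras"
begin

text \<open>
  Scalars range over a type \<open>'k\<close> of sort \<open>{real_normed_field, euclidean_space}\<close>. Both \<open>real\<close> and
  \<open>complex\<close> are of this sort, and up to isomorphism they are the only ones.
  Functions on the probability space are total functions \<open>'a \<Rightarrow> 'k\<close>; they are not identified when
  they agree almost everywhere.
\<close>

section \<open>Filtrations, atoms and rings\<close>

definition atoms_at :: "(nat \<Rightarrow> 'a measure) \<Rightarrow> nat \<Rightarrow> 'a set set" where
  "atoms_at F n = {A \<in> sets (F n). A \<noteq> {} \<and> (\<forall>B\<in>sets (F n). B \<subseteq> A \<longrightarrow> B = {} \<or> B = A)}"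

definition all_atoms :: "(nat \<Rightarrow> 'a measure) \<Rightarrow> 'a set set" where
  "all_atoms F = (\<Union>n. atoms_at F n)"

definition rings :: "(nat \<Rightarrow> 'a measure) \<Rightarrow> 'a set set" where
  "rings F = {A - B | A B. A \<in> all_atoms F \<and> B \<in> all_atoms F \<and> B \<subset> A}"

text \<open>
  As usual in the library, the \<open>\<sigma>\<close>-algebra \<open>\<F>\<^sub>n\<close> is represented by a measure \<open>F n\<close>, of which only
  \<open>space\<close> and \<open>sets\<close> matter; all measures of sets are taken in \<open>P\<close>.
\<close>

definition nary_filtration :: "'a measure \<Rightarrow> nat \<Rightarrow> (nat \<Rightarrow> 'a measure) \<Rightarrow> bool" where
  "nary_filtration P \<nu> F \<longleftrightarrow>
     filtration (space P) F \<and>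
     (\<forall>n. subalgebra P (F n)) \<and>
     (\<forall>n. finite (sets (F n))) \<and>
     sets (F 0) = {{}, space P} \<and>
     (\<forall>n\<ge>1. \<forall>A\<in>atoms_at F (n - 1).
        \<exists>\<B>\<subseteq>atoms_at F n. finite \<B> \<and> card \<B> \<le> \<nu> \<and> A = \<Union>\<B>) \<and>
     (\<forall>A\<in>all_atoms F. measure P A > 0)"

section \<open>The function space \<open>S\<close>\<close>

definition fscale :: "'k::field \<Rightarrow> ('a \<Rightarrow> 'k) \<Rightarrow> 'a \<Rightarrow> 'k" where
  "fscale c f = (\<lambda>x. c * f x)"

lemma vector_space_fscale: "vector_space (fscale :: 'k::field \<Rightarrow> ('a \<Rightarrow> 'k) \<Rightarrow> 'a \<Rightarrow> 'k)"
  by unfold_locales (auto simp: fscale_def fun_eq_iff algebra_simps)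

definition fin_dim_function_space :: "('a \<Rightarrow> 'k::field) set \<Rightarrow> bool" where
  "fin_dim_function_space S \<longleftrightarrow>
     module.subspace fscale S \<and> (\<exists>B. finite B \<and> B \<subseteq> S \<and> module.span fscale B = S)"

definition Linf_norm_on :: "'a measure \<Rightarrow> 'a set \<Rightarrow> ('a \<Rightarrow> 'k::real_normed_vector) \<Rightarrow> ennreal" where
  "Linf_norm_on P A f = esssup (restrict_space P A) (\<lambda>x. ennreal (norm (f x)))"

definition admissible_space ::
  "'a measure \<Rightarrow> (nat \<Rightarrow> 'a measure) \<Rightarrow> ('a \<Rightarrow> 'k::{real_normed_field, euclidean_space}) set \<Rightarrow> bool"
where
  "admissible_space P F S \<longleftrightarrow>
     fin_dim_function_space S \<and>
     (\<forall>f\<in>S. f \<in> borel_measurable P \<and> bounded (f ` space P)) \<and>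
     (\<exists>c1\<in>{0<..1::real}. \<exists>c2\<in>{0<..1::real}. \<forall>A\<in>all_atoms F. \<forall>f\<in>S.
        measure P {x\<in>A. ennreal (norm (f x)) \<ge> ennreal c1 * Linf_norm_on P A f} \<ge> c2 * measure P A)"

definition restr :: "'a set \<Rightarrow> ('a \<Rightarrow> 'k::field) \<Rightarrow> 'a \<Rightarrow> 'k" where
  "restr R f = (\<lambda>x. f x * indicator R x)"

section \<open>\<open>L\<^sup>p\<close>, approximation errors and the variation\<close>

definition in_Lp :: "'a measure \<Rightarrow> real \<Rightarrow> ('a \<Rightarrow> 'k::{real_normed_field, euclidean_space}) \<Rightarrow> bool" where
  "in_Lp P p f \<longleftrightarrow> f \<in> borel_measurable P \<and> integrable P (\<lambda>x. norm (f x) powr p)"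

text \<open>
  The (quasi-)norm of \<open>L\<^sup>p(R)\<close>, meaningful for functions in \<open>L\<^sup>p\<close> only: the Bochner integral
  of a non-integrable function is \<open>0\<close>.
\<close>

definition Lp_norm_on ::
  "'a measure \<Rightarrow> real \<Rightarrow> 'a set \<Rightarrow> ('a \<Rightarrow> 'k::{real_normed_field, euclidean_space}) \<Rightarrow> real" where
  "Lp_norm_on P p R f = (LINT x:R|P. norm (f x) powr p) powr (1 / p)"

definition LpS ::
  "'a measure \<Rightarrow> (nat \<Rightarrow> 'a measure) \<Rightarrow> ('a \<Rightarrow> 'k::{real_normed_field, euclidean_space}) set \<Rightarrow> real
    \<Rightarrow> ('a \<Rightarrow> 'k) set" where
  "LpS P F S p = {f. in_Lp P p f \<and>
     (\<forall>\<epsilon>>0. \<exists>g\<in>module.span fscale {restr A h | h A. h \<in> S \<and> A \<in> all_atoms F}.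
        Lp_norm_on P p (space P) (\<lambda>x. f x - g x) < \<epsilon>)}"

definition approx_error ::
  "'a measure \<Rightarrow> ('a \<Rightarrow> 'k::{real_normed_field, euclidean_space}) set \<Rightarrow> real
    \<Rightarrow> ('a \<Rightarrow> 'k) \<Rightarrow> 'a set \<Rightarrow> real" where
  "approx_error P S p f R = (INF g\<in>restr R ` S. Lp_norm_on P p R (\<lambda>x. f x - g x))"

definition variation ::
  "'a measure \<Rightarrow> (nat \<Rightarrow> 'a measure) \<Rightarrow> ('a \<Rightarrow> 'k::{real_normed_field, euclidean_space}) set
    \<Rightarrow> real \<Rightarrow> real \<Rightarrow> ('a \<Rightarrow> 'k) \<Rightarrow> ennreal" where
  "variation P F S \<sigma> p f =
     (SUP \<R>\<in>{\<R>. finite \<R> \<and> \<R> \<subseteq> all_atoms F \<union> rings F \<and> disjoint \<R>}.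
        ennreal ((\<Sum>R\<in>\<R>. approx_error P S p f R powr \<sigma>) powr (1 / \<sigma>)))"

section \<open>Near-best approximation operators\<close>

definition near_best ::
  "'a measure \<Rightarrow> ('a \<Rightarrow> 'k::{real_normed_field, euclidean_space}) set \<Rightarrow> real \<Rightarrow> real
    \<Rightarrow> 'a set \<Rightarrow> ('a \<Rightarrow> 'k) \<Rightarrow> ('a \<Rightarrow> 'k) \<Rightarrow> bool" where
  "near_best P S p M A f h \<longleftrightarrow>
     h \<in> S \<and> (\<forall>g\<in>S. Lp_norm_on P p A (\<lambda>x. h x - g x) \<le> M * Lp_norm_on P p A (\<lambda>x. f x - g x))"

text \<open>The operator \<open>W\<^sub>\<mu>\<close> belonging to a choice \<open>\<phi>\<close> of local approximants, \<open>f\<^sub>A = \<phi> f A\<close>.\<close>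

definition W_op ::
  "(nat \<Rightarrow> 'a measure) \<Rightarrow> (('a \<Rightarrow> 'k::field) \<Rightarrow> 'a set \<Rightarrow> 'a \<Rightarrow> 'k) \<Rightarrow> nat \<Rightarrow> ('a \<Rightarrow> 'k) \<Rightarrow> 'a \<Rightarrow> 'k" where
  "W_op F \<phi> \<mu> f = (\<lambda>x. \<Sum>A\<in>atoms_at F \<mu>. restr A (\<phi> f A) x)"

end

theory Submission
  imports Defs
begin

text \<open>
  Write the \<open>p\<close>-th power of \<open>E\<^sub>p(f, R)\<close> as the infimum, over \<open>h \<in> S\<close>, of the energy
  \<open>\<integral>\<^bsub>R\<^esub> |f - h|\<^sup>p\<close>. Energies are additive in \<open>R\<close>, so the defining property of the local approximants
  \<open>f\<^sub>A\<close> extends from single atoms of level \<open>\<mu>\<close> to all of their unions: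
  the energy of \<open>W\<^sub>\<mu> f - g\<close> is at most \<open>M\<^sup>p\<close> times that of \<open>f - g\<close> for every \<open>g\<close> that coincides
  with some element of \<open>S\<close> on each of these atoms (\<open>W_op_energy_le\<close>). Everything follows from this
  inequality.

  Convergence: a linear combination \<open>g\<close> of functions \<open>h 1\<^sub>A\<close> that is close to \<open>f\<close> is an admissible
  competitor for all large \<open>\<mu>\<close>, so that \<open>W\<^sub>\<mu> f\<close> is close to \<open>g\<close> and hence to \<open>f\<close>.

  Upper bound by \<open>M |f|\<^sub>V\<close>: take a disjoint collection of atoms and rings. If a piece \<open>R\<close> lies inside
  an atom of level \<open>\<mu>\<close>, then \<open>W\<^sub>\<mu> f\<close> coincides on \<open>R\<close> with an element of \<open>S\<close> and has error \<open>0\<close>.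
  Otherwise enlarge \<open>R\<close> to its saturation \<open>R\<^sup>*\<close>, the union of the atoms of level \<open>\<mu>\<close> that meet it;
  then \<open>E\<^sub>p(W\<^sub>\<mu> f, R) \<le> E\<^sub>p(W\<^sub>\<mu> f, R\<^sup>*) \<le> M E\<^sub>p(f, R\<^sup>*)\<close>. The combinatorial
  heart is that these saturations are again atoms or rings, and again disjoint
  (\<open>saturation_atom_or_ring\<close>, \<open>saturation_disjoint\<close>), so that they are a competing collection for
  the variation of \<open>f\<close>.

  Lower bound by \<open>|f|\<^sub>V\<close>: for a fixed piece \<open>R\<close> the error \<open>E\<^sub>p(_, R)\<close> is continuous under \<open>L\<^sup>p\<close>
  convergence (\<open>approx_error_tendsto\<close>), so the variation is lower semicontinuous as a supremum of
  continuous functionals.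
\<close>

section \<open>Atoms of a filtration and saturated sets\<close>

locale nary_filtered =
  fixes P :: "'a measure" and \<nu> :: nat and F :: "nat \<Rightarrow> 'a measure"
  assumes nary: "nary_filtration P \<nu> F"
begin

lemma space_F [simp]: "space (F n) = space P"
  using nary by (auto simp: nary_filtration_def subalgebra_def)

lemma finite_sets_F: "finite (sets (F n))"
  using nary by (auto simp: nary_filtration_def)

lemma sets_F_subset: "sets (F n) \<subseteq> sets P"
  using nary by (auto simp: nary_filtration_def subalgebra_def)

lemma sets_F_mono: "m \<le> n \<Longrightarrow> sets (F m) \<subseteq> sets (F n)"
  using nary by (simp add: nary_filtration_def filtration_def)

lemma atoms_at_sets: "A \<in> atoms_at F n \<Longrightarrow> A \<in> sets (F n)"
  by (simp add: atoms_at_def)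

lemma atoms_at_nonempty: "A \<in> atoms_at F n \<Longrightarrow> A \<noteq> {}"
  by (simp add: atoms_at_def)

lemma finite_atoms_at: "finite (atoms_at F n)"
  by (rule finite_subset [OF _ finite_sets_F [of n]]) (auto simp: atoms_at_def)

lemma atom_subset_of_meets:
  assumes "A \<in> atoms_at F n" "X \<in> sets (F n)" "A \<inter> X \<noteq> {}"
  shows "A \<subseteq> X"
proof -
  have "A \<inter> X \<in> sets (F n)"
    using assms atoms_at_sets by blast
  then have "A \<inter> X = {} \<or> A \<inter> X = A"
    using assms(1) by (simp add: atoms_at_def)
  then show ?thesis
    using assms(3) by blast
qed

lemma atoms_at_eq_of_meets:
  assumes "A \<in> atoms_at F n" "B \<in> atoms_at F n" "A \<inter> B \<noteq> {}"
  shows "A = B"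
  using atom_subset_of_meets [of A n B] atom_subset_of_meets [of B n A] assms atoms_at_sets
  by blast

text \<open>
  A finite \<open>\<sigma>\<close>-algebra is generated by its atoms: the intersection of the finitely many sets
  containing a point is itself measurable, and it is an atom.
\<close>

lemma atom_through_point:
  assumes "x \<in> space P"
  obtains A where "A \<in> atoms_at F n" "x \<in> A"
proof -
  let ?\<X> = "{X \<in> sets (F n). x \<in> X}"
  let ?A = "\<Inter>?\<X>"
  have fin: "finite ?\<X>"
    using finite_sets_F [of n] by simp
  have top: "space P \<in> ?\<X>"
    using assms sets.top [of "F n"] by simp
  have meas: "?A \<in> sets (F n)"
    using sets.finite_INT [OF fin, of id "F n"] top by auto
  have "B = {} \<or> B = ?A" if B: "B \<in> sets (F n)" "B \<subseteq> ?A" for B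
  proof (cases "x \<in> B")
    case True
    then show ?thesis using B by blast
  next
    case False
    then have "space P - B \<in> ?\<X>"
      using B(1) assms sets.compl_sets [of B "F n"] by simp
    then have "?A \<subseteq> space P - B"
      by blast
    then show ?thesis using B(2) by blast
  qed
  then have "?A \<in> atoms_at F n"
    using meas unfolding atoms_at_def by blast
  then show thesis
    by (rule that) blast
qed

lemma sets_F_eq_Union_atoms:
  assumes "X \<in> sets (F n)"
  shows "X = \<Union>{A \<in> atoms_at F n. A \<subseteq> X}"
proof
  show "X \<subseteq> \<Union>{A \<in> atoms_at F n. A \<subseteq> X}"
  proof
    fix x assume "x \<in> X"
    moreover from this have "x \<in> space P"
      using sets.sets_into_space [OF assms] by auto
    then obtain A where "A \<in> atoms_at F n" "x \<in> A"
      by (rule atom_through_point)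
    ultimately show "x \<in> \<Union>{A \<in> atoms_at F n. A \<subseteq> X}"
      using atom_subset_of_meets [OF _ assms] by blast
  qed
qed blast

lemma atom_coarser_or_finer:
  assumes "A \<in> all_atoms F" "C \<in> atoms_at F \<mu>" "A \<inter> C \<noteq> {}" "\<not> A \<subseteq> C"
  shows "A \<in> sets (F \<mu>)"
proof -
  obtain n where n: "A \<in> atoms_at F n"
    using assms(1) by (auto simp: all_atoms_def)
  have "n \<le> \<mu>"
  proof (rule ccontr)
    assume "\<not> n \<le> \<mu>"
    then have "C \<in> sets (F n)"
      using sets_F_mono [of \<mu> n] atoms_at_sets [OF assms(2)] by auto
    then show False
      using atom_subset_of_meets [OF n] assms by blast
  qed
  then show ?thesis
    using sets_F_mono atoms_at_sets [OF n] by blast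
qed

lemma atoms_nested_or_disjoint:
  assumes "A \<in> all_atoms F" "B \<in> all_atoms F"
  shows "A \<subseteq> B \<or> B \<subseteq> A \<or> A \<inter> B = {}"
proof -
  obtain n where n: "B \<in> atoms_at F n"
    using assms(2) by (auto simp: all_atoms_def)
  show ?thesis
    using atom_coarser_or_finer [OF assms(1) n] atom_subset_of_meets [OF n] by blast
qed

lemma all_atoms_nonempty: "A \<in> all_atoms F \<Longrightarrow> A \<noteq> {}"
  by (auto simp: all_atoms_def dest: atoms_at_nonempty)

lemma all_atoms_sets: "A \<in> all_atoms F \<Longrightarrow> A \<in> sets P"
  using atoms_at_sets sets_F_subset unfolding all_atoms_def by blast

lemma atom_or_ring_cases:
  assumes "R \<in> all_atoms F \<union> rings F"
  obtains A B where "R = A - B" "A \<in> all_atoms F" "B = {} \<or> B \<in> all_atoms F" "B \<subset> A"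
proof (cases "R \<in> all_atoms F")
  case True
  then show ?thesis
    using that [of R "{}"] all_atoms_nonempty by blast
next
  case False
  then show ?thesis
    using assms that unfolding rings_def by blast
qed

lemma atom_or_ring_nonempty: "R \<in> all_atoms F \<union> rings F \<Longrightarrow> R \<noteq> {}"
  by (erule atom_or_ring_cases) blast

lemma atom_or_ring_sets: "R \<in> all_atoms F \<union> rings F \<Longrightarrow> R \<in> sets P"
  by (erule atom_or_ring_cases, erule disjE) (simp_all add: all_atoms_sets sets.Diff)

definition saturation :: "nat \<Rightarrow> 'a set \<Rightarrow> 'a set" where
  "saturation \<mu> R = \<Union>{C \<in> atoms_at F \<mu>. C \<inter> R \<noteq> {}}"

lemma saturation_sets: "saturation \<mu> R \<in> sets (F \<mu>)"
  unfolding saturation_def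
  by (rule sets.finite_Union) (auto intro: finite_subset [OF _ finite_atoms_at] atoms_at_sets)

lemma subset_saturation:
  assumes "R \<subseteq> space P"
  shows "R \<subseteq> saturation \<mu> R"
proof
  fix x assume "x \<in> R"
  moreover from this obtain C where "C \<in> atoms_at F \<mu>" "x \<in> C"
    using atom_through_point assms by blast
  ultimately show "x \<in> saturation \<mu> R"
    unfolding saturation_def by blast
qed

lemma saturation_subset:
  assumes "R \<subseteq> X" "X \<in> sets (F \<mu>)"
  shows "saturation \<mu> R \<subseteq> X"
  unfolding saturation_def
proof (rule Union_least)
  fix C assume "C \<in> {C \<in> atoms_at F \<mu>. C \<inter> R \<noteq> {}}"
  then show "C \<subseteq> X"
    using assms by (intro atom_subset_of_meets [OF _ assms(2)]) auto
qed

text \<open>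
  Passing to the saturation does not leave the class of atoms and rings: if \<open>R = A - B\<close> is not
  inside a single atom of level \<open>\<mu>\<close>, then \<open>A\<close> is already \<open>\<F>\<^sub>\<mu>\<close>-measurable, and either \<open>B\<close> is
  too, so that \<open>R\<close> is its own saturation, or \<open>B\<close> is a proper part of an atom of level \<open>\<mu>\<close>, so that
  saturating fills the hole and returns \<open>A\<close>.
\<close>

lemma saturation_atom_or_ring:
  assumes R: "R \<in> all_atoms F \<union> rings F"
    and spread: "\<And>C. C \<in> atoms_at F \<mu> \<Longrightarrow> \<not> R \<subseteq> C"
  shows "saturation \<mu> R \<in> all_atoms F \<union> rings F"
proof -
  obtain A B where RAB: "R = A - B" "A \<in> all_atoms F" "B = {} \<or> B \<in> all_atoms F" "B \<subset> A"
    using R by (rule atom_or_ring_cases)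
  have R_space: "R \<subseteq> space P"
    by (rule sets.sets_into_space [OF atom_or_ring_sets [OF R]])
  obtain x where x: "x \<in> R" "x \<in> space P"
    using atom_or_ring_nonempty [OF R] R_space by blast
  obtain C where C: "C \<in> atoms_at F \<mu>" "x \<in> C"
    using atom_through_point [OF x(2)] .
  have A: "A \<in> sets (F \<mu>)"
    using atom_coarser_or_finer [OF RAB(2) C(1)] x C spread [OF C(1)] RAB(1) by blast
  show ?thesis
  proof (cases "B \<in> sets (F \<mu>)")
    case True
    then have "R \<in> sets (F \<mu>)"
      using A RAB(1) by auto
    then have "saturation \<mu> R = R"
      using saturation_subset [of R R] subset_saturation [OF R_space] by blast
    then show ?thesis using R by simp
  next
    case False
    have B: "B \<in> all_atoms F"
      using False RAB(3) by auto
    have "A \<subseteq> saturation \<mu> R"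
    proof
      fix y assume y: "y \<in> A"
      then have "y \<in> space P"
        using sets.sets_into_space [OF A] by auto
      then obtain D where D: "D \<in> atoms_at F \<mu>" "y \<in> D"
        by (rule atom_through_point)
      have "D \<subseteq> A"
        using atom_subset_of_meets [OF D(1) A] D(2) y by blast
      moreover have "\<not> D \<subseteq> B"
      proof
        assume "D \<subseteq> B"
        moreover from this have "B \<subseteq> D"
          using atom_coarser_or_finer [OF B D(1)] False atoms_at_nonempty [OF D(1)] by auto
        ultimately show False
          using False atoms_at_sets [OF D(1)] by simp
      qed
      ultimately show "y \<in> saturation \<mu> R"
        using D RAB(1) unfolding saturation_def by blast
    qed
    then have "saturation \<mu> R = A"
      using saturation_subset [OF _ A, of R] RAB(1) by blast
    then show ?thesis using RAB(2) by simp
  qed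
qed

text \<open>
  Saturations of disjoint pieces can only meet in an atom \<open>C\<close> of level \<open>\<mu>\<close> that meets both pieces
  \<open>A\<^sub>1 - B\<^sub>1\<close> and \<open>A\<^sub>2 - B\<^sub>2\<close>. As neither piece lies in \<open>C\<close>, both \<open>A\<^sub>1\<close> and \<open>A\<^sub>2\<close> properly contain
  \<open>C\<close>, whereas both holes have to lie in \<open>C\<close> in order to keep the pieces disjoint there. Outside
  \<open>C\<close> the pieces then coincide with \<open>A\<^sub>1\<close> and \<open>A\<^sub>2\<close>, which are nested; so they are not disjoint.
\<close>

lemma saturation_disjoint:
  assumes R1: "R1 \<in> all_atoms F \<union> rings F" and R2: "R2 \<in> all_atoms F \<union> rings F"
    and disj: "R1 \<inter> R2 = {}"
    and spread1: "\<And>C. C \<in> atoms_at F \<mu> \<Longrightarrow> \<not> R1 \<subseteq> C"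
    and spread2: "\<And>C. C \<in> atoms_at F \<mu> \<Longrightarrow> \<not> R2 \<subseteq> C"
  shows "saturation \<mu> R1 \<inter> saturation \<mu> R2 = {}"
proof (rule ccontr)
  assume "saturation \<mu> R1 \<inter> saturation \<mu> R2 \<noteq> {}"
  then obtain x where x: "x \<in> saturation \<mu> R1" "x \<in> saturation \<mu> R2"
    by auto
  obtain C where C: "C \<in> atoms_at F \<mu>" "C \<inter> R1 \<noteq> {}" "x \<in> C"
    using x(1) by (auto simp: saturation_def)
  obtain C' where C': "C' \<in> atoms_at F \<mu>" "C' \<inter> R2 \<noteq> {}" "x \<in> C'"
    using x(2) by (auto simp: saturation_def)
  have "C' = C"
    using C(3) C'(3) by (intro atoms_at_eq_of_meets [OF C'(1) C(1)]) auto
  with C'(2) have C_R2: "C \<inter> R2 \<noteq> {}"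
    by simp
  have C_atom: "C \<in> all_atoms F"
    using C(1) by (auto simp: all_atoms_def)
  obtain A1 B1 where 1: "R1 = A1 - B1" "A1 \<in> all_atoms F" "B1 = {} \<or> B1 \<in> all_atoms F" "B1 \<subset> A1"
    using R1 by (rule atom_or_ring_cases)
  obtain A2 B2 where 2: "R2 = A2 - B2" "A2 \<in> all_atoms F" "B2 = {} \<or> B2 \<in> all_atoms F" "B2 \<subset> A2"
    using R2 by (rule atom_or_ring_cases)
  have A1: "C \<subseteq> A1"
    using atoms_nested_or_disjoint [OF 1(2) C_atom] C(2) spread1 [OF C(1)] 1(1) by blast
  have A2: "C \<subseteq> A2"
    using atoms_nested_or_disjoint [OF 2(2) C_atom] C_R2 spread2 [OF C(1)] 2(1) by blast
  have cover: "C \<subseteq> B1 \<union> B2"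
    using A1 A2 disj 1(1) 2(1) by blast
  have "\<not> C \<subseteq> B1" "\<not> C \<subseteq> B2"
    using C(2) C_R2 1(1) 2(1) by blast+
  moreover have "B1 = {} \<or> B1 \<subseteq> C \<or> C \<subseteq> B1 \<or> B1 \<inter> C = {}"
      "B2 = {} \<or> B2 \<subseteq> C \<or> C \<subseteq> B2 \<or> B2 \<inter> C = {}"
    using atoms_nested_or_disjoint [OF _ C_atom] 1(3) 2(3) by auto
  ultimately have B1: "B1 \<subseteq> C" and B2: "B2 \<subseteq> C"
    using cover by blast+
  have "A1 - C \<noteq> {}" "A2 - C \<noteq> {}"
    using spread1 [OF C(1)] spread2 [OF C(1)] 1(1) 2(1) by blast+
  moreover have "A1 \<subseteq> A2 \<or> A2 \<subseteq> A1"
    using atoms_nested_or_disjoint [OF 1(2) 2(2)] A1 A2 atoms_at_nonempty [OF C(1)] by blast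
  ultimately show False
    using B1 B2 disj 1(1) 2(1) by blast
qed

end

section \<open>Energies and approximation errors\<close>

text \<open>
  The \<open>p\<close>-th power of the (quasi-)norm of \<open>L\<^sup>p(R)\<close>. Unlike the norm it is additive in \<open>R\<close>.
\<close>

definition Lp_energy ::
  "'a measure \<Rightarrow> real \<Rightarrow> 'a set \<Rightarrow> ('a \<Rightarrow> 'k::{real_normed_field, euclidean_space}) \<Rightarrow> real" where
  "Lp_energy P p R f = (LINT x:R|P. norm (f x) powr p)"

lemma Lp_energy_nonneg: "0 \<le> Lp_energy P p R f"
  unfolding Lp_energy_def set_lebesgue_integral_def by (rule Bochner_Integration.integral_nonneg) auto

lemma Lp_norm_on_nonneg: "0 \<le> Lp_norm_on P p R f"
  by (simp add: Lp_norm_on_def)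

lemma Lp_norm_on_eq: "Lp_norm_on P p R f = Lp_energy P p R f powr (1 / p)"
  by (simp add: Lp_norm_on_def Lp_energy_def)

lemma Lp_norm_on_powr: "p > 0 \<Longrightarrow> Lp_norm_on P p R f powr p = Lp_energy P p R f"
  by (simp add: Lp_norm_on_eq powr_powr Lp_energy_nonneg)

lemma Lp_energy_cong:
  assumes "\<And>x. x \<in> R \<Longrightarrow> f x = g x"
  shows "Lp_energy P p R f = Lp_energy P p R g"
  unfolding Lp_energy_def set_lebesgue_integral_def
  by (rule Bochner_Integration.integral_cong) (auto simp: indicator_def assms)

text \<open>
  A triangle inequality valid for every exponent \<open>p > 0\<close>, whose factor in front of the first summand
  is as close to \<open>1\<close> as desired: compare \<open>b\<close> with \<open>\<eta> * a\<close>.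
\<close>

lemma powr_add_le:
  fixes a b \<eta> p :: real
  assumes "0 \<le> a" "0 \<le> b" "0 < \<eta>" "0 < p"
  shows "(a + b) powr p \<le> (1 + \<eta>) powr p * a powr p + (1 + 1 / \<eta>) powr p * b powr p"
proof (cases "b \<le> \<eta> * a")
  case True
  then have "(a + b) powr p \<le> ((1 + \<eta>) * a) powr p"
    using assms by (intro powr_mono2) (auto simp: algebra_simps)
  then show ?thesis
    using assms by (simp add: powr_mult add_increasing2)
next
  case False
  then have "a \<le> b / \<eta>"
    using assms by (simp add: field_simps)
  then have "(a + b) powr p \<le> ((1 + 1 / \<eta>) * b) powr p"
    using assms by (intro powr_mono2) (auto simp: algebra_simps)
  then show ?thesis
    using assms by (simp add: powr_mult add_increasing)
qed

lemma in_Lp_cmult: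
  assumes "in_Lp P p f"
  shows "in_Lp P p (\<lambda>x. c * f x)"
  using assms unfolding in_Lp_def by (auto simp: norm_mult powr_mult)

lemma in_Lp_add:
  assumes "p > 0" "in_Lp P p f" "in_Lp P p g"
  shows "in_Lp P p (\<lambda>x. f x + g x)"
  unfolding in_Lp_def
proof
  show meas: "(\<lambda>x. f x + g x) \<in> borel_measurable P"
    using assms by (auto simp: in_Lp_def)
  show "integrable P (\<lambda>x. norm (f x + g x) powr p)"
  proof (rule Bochner_Integration.integrable_bound)
    show "integrable P (\<lambda>x. 2 powr p * norm (f x) powr p + 2 powr p * norm (g x) powr p)"
      using assms by (auto simp: in_Lp_def)
    show "(\<lambda>x. norm (f x + g x) powr p) \<in> borel_measurable P"
      using meas by measurable
    have "norm (f x + g x) powr p \<le> 2 powr p * norm (f x) powr p + 2 powr p * norm (g x) powr p" for x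
    proof -
      have "norm (f x + g x) powr p \<le> (norm (f x) + norm (g x)) powr p"
        using assms(1) by (intro powr_mono2 norm_triangle_ineq) auto
      also have "\<dots> \<le> 2 powr p * norm (f x) powr p + 2 powr p * norm (g x) powr p"
        using powr_add_le [of "norm (f x)" "norm (g x)" 1 p] assms(1) by simp
      finally show ?thesis .
    qed
    then show "AE x in P. norm (norm (f x + g x) powr p)
        \<le> norm (2 powr p * norm (f x) powr p + 2 powr p * norm (g x) powr p)"
      by auto
  qed
qed

lemma in_Lp_diff:
  assumes "p > 0" "in_Lp P p f" "in_Lp P p g"
  shows "in_Lp P p (\<lambda>x. f x - g x)"
  using in_Lp_add [OF assms(1,2) in_Lp_cmult [OF assms(3), of "-1"]] by simp

lemma in_Lp_sum:
  assumes "p > 0" "finite I" "\<And>i. i \<in> I \<Longrightarrow> in_Lp P p (f i)"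
  shows "in_Lp P p (\<lambda>x. \<Sum>i\<in>I. f i x)"
  using assms(2,3)
proof (induction I rule: finite_induct)
  case empty
  then show ?case by (simp add: in_Lp_def)
next
  case (insert i I)
  then show ?case
    using in_Lp_add [OF assms(1), of P "f i" "\<lambda>x. \<Sum>i\<in>I. f i x"] by simp
qed

lemma in_Lp_restr:
  assumes "in_Lp P p f" "A \<in> sets P"
  shows "in_Lp P p (restr A f)"
  unfolding in_Lp_def restr_def
proof
  have f: "f \<in> borel_measurable P" "integrable P (\<lambda>x. norm (f x) powr p)"
    using assms(1) by (auto simp: in_Lp_def)
  show "(\<lambda>x. f x * indicator A x) \<in> borel_measurable P"
    using f(1) assms(2) by measurable
  have "(\<lambda>x. norm (f x * indicator A x) powr p) = (\<lambda>x. norm (f x) powr p * indicator A x)"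
    by (auto simp: indicator_def fun_eq_iff)
  then show "integrable P (\<lambda>x. norm (f x * indicator A x) powr p)"
    using integrable_real_mult_indicator [OF assms(2) f(2)] by (simp add: mult.commute)
qed

lemma (in finite_measure) in_Lp_bounded:
  assumes "p > 0" "f \<in> borel_measurable M" "bounded (f ` space M)"
  shows "in_Lp M p f"
  unfolding in_Lp_def
proof
  obtain c where c: "\<And>x. x \<in> space M \<Longrightarrow> norm (f x) \<le> c"
    using assms(3) by (auto simp: bounded_iff)
  have "norm (f x) powr p \<le> \<bar>c\<bar> powr p" if "x \<in> space M" for x
    using c [OF that] assms(1) by (intro powr_mono2) auto
  then show "integrable M (\<lambda>x. norm (f x) powr p)"
    using assms(2) by (intro integrable_const_bound [where B = "\<bar>c\<bar> powr p"]) auto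
qed fact

lemma in_Lp_set_integrable:
  assumes "in_Lp P p f" "R \<in> sets P"
  shows "set_integrable P R (\<lambda>x. norm (f x) powr p)"
  unfolding set_integrable_def using assms by (intro integrable_mult_indicator) (auto simp: in_Lp_def)

lemma Lp_energy_subset_mono:
  assumes "in_Lp P p f" "R \<subseteq> R'" "R \<in> sets P" "R' \<in> sets P"
  shows "Lp_energy P p R f \<le> Lp_energy P p R' f"
  unfolding Lp_energy_def set_lebesgue_integral_def
proof (rule integral_mono)
  show "integrable P (\<lambda>x. indicat_real R x *\<^sub>R norm (f x) powr p)"
      "integrable P (\<lambda>x. indicat_real R' x *\<^sub>R norm (f x) powr p)"
    using in_Lp_set_integrable [OF assms(1)] assms(3,4) by (auto simp: set_integrable_def)
qed (use assms(2) in \<open>auto simp: indicator_def\<close>)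

lemma Lp_energy_finite_Union:
  assumes "in_Lp P p f" "finite \<C>" "disjoint \<C>" "\<C> \<subseteq> sets P"
  shows "Lp_energy P p (\<Union>\<C>) f = (\<Sum>C\<in>\<C>. Lp_energy P p C f)"
proof -
  have "set_integrable P C (\<lambda>x. norm (f x) powr p)" if "C \<in> \<C>" for C
    using that assms by (intro in_Lp_set_integrable) auto
  moreover have "disjoint_family_on id \<C>"
    using assms(3) by (auto simp: disjoint_family_on_def pairwise_def disjnt_def)
  ultimately show ?thesis
    unfolding Lp_energy_def
    using set_integral_finite_Union [of \<C> id P "\<lambda>x. norm (f x) powr p"] assms(2,4) by auto
qed

lemma Lp_energy_minus_commute:
  "Lp_energy P p R (\<lambda>x. f x - g x) = Lp_energy P p R (\<lambda>x. g x - f x)"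
  by (simp add: Lp_energy_def norm_minus_commute)

lemma Lp_energy_triangle:
  assumes "p > 0" "\<eta> > 0" "R \<in> sets P" "in_Lp P p f" "in_Lp P p g" "in_Lp P p h"
  shows "Lp_energy P p R (\<lambda>x. f x - h x) \<le> (1 + \<eta>) powr p * Lp_energy P p R (\<lambda>x. g x - h x)
    + (1 + 1 / \<eta>) powr p * Lp_energy P p R (\<lambda>x. f x - g x)"
proof -
  let ?a = "\<lambda>x. norm (g x - h x) powr p" and ?b = "\<lambda>x. norm (f x - g x) powr p"
  have int: "set_integrable P R ?a" "set_integrable P R ?b"
      "set_integrable P R (\<lambda>x. norm (f x - h x) powr p)"
    using assms by (auto intro!: in_Lp_set_integrable in_Lp_diff)
  have "norm (f x - h x) powr p \<le> (1 + \<eta>) powr p * ?a x + (1 + 1 / \<eta>) powr p * ?b x" for x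
  proof -
    have "norm (f x - h x) powr p \<le> (norm (g x - h x) + norm (f x - g x)) powr p"
      using assms(1) norm_triangle_ineq [of "g x - h x" "f x - g x"] by (intro powr_mono2) auto
    also have "\<dots> \<le> (1 + \<eta>) powr p * ?a x + (1 + 1 / \<eta>) powr p * ?b x"
      using assms(1,2) by (intro powr_add_le) auto
    finally show ?thesis .
  qed
  then have "Lp_energy P p R (\<lambda>x. f x - h x)
      \<le> (LINT x:R|P. (1 + \<eta>) powr p * ?a x + (1 + 1 / \<eta>) powr p * ?b x)"
    unfolding Lp_energy_def using int by (intro set_integral_mono) auto
  also have "\<dots> = (1 + \<eta>) powr p * Lp_energy P p R (\<lambda>x. g x - h x)
      + (1 + 1 / \<eta>) powr p * Lp_energy P p R (\<lambda>x. f x - g x)"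
    unfolding Lp_energy_def using int by simp
  finally show ?thesis .
qed

lemma approx_error_eq: "approx_error P S p f R = (INF h\<in>S. Lp_norm_on P p R (\<lambda>x. f x - h x))"
proof -
  have "Lp_norm_on P p R (\<lambda>x. f x - restr R h x) = Lp_norm_on P p R (\<lambda>x. f x - h x)" for h
    unfolding Lp_norm_on_eq by (subst Lp_energy_cong [where g = "\<lambda>x. f x - h x"]) (auto simp: restr_def)
  then show ?thesis
    by (simp add: approx_error_def image_comp)
qed

lemma approx_error_nonneg: "S \<noteq> {} \<Longrightarrow> 0 \<le> approx_error P S p f R"
  unfolding approx_error_eq by (rule cINF_greatest) (auto simp: Lp_norm_on_nonneg)

text \<open>
  The following two lemmas say that the \<open>p\<close>-th power of the approximation error is the infimum of
  the energies of \<open>f - h\<close> over \<open>h \<in> S\<close>.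
\<close>

lemma approx_error_powr_le:
  assumes "p > 0" "h \<in> S"
  shows "approx_error P S p f R powr p \<le> Lp_energy P p R (\<lambda>x. f x - h x)"
proof -
  have "approx_error P S p f R \<le> Lp_norm_on P p R (\<lambda>x. f x - h x)"
    unfolding approx_error_eq
    by (rule cINF_lower) (auto simp: assms Lp_norm_on_nonneg intro!: bdd_belowI [where m = 0])
  then have "approx_error P S p f R powr p \<le> Lp_norm_on P p R (\<lambda>x. f x - h x) powr p"
    using assms approx_error_nonneg [of S P p f R] by (intro powr_mono2) auto
  then show ?thesis
    by (simp add: Lp_norm_on_powr assms)
qed

lemma le_approx_error_powr:
  assumes "p > 0" "S \<noteq> {}" "\<And>h. h \<in> S \<Longrightarrow> c \<le> Lp_energy P p R (\<lambda>x. f x - h x)"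
  shows "c \<le> approx_error P S p f R powr p"
proof (cases "c \<le> 0")
  case True
  then show ?thesis
    by (rule order_trans) simp
next
  case False
  have "c powr (1 / p) \<le> approx_error P S p f R"
    unfolding approx_error_eq
  proof (rule cINF_greatest [OF assms(2)])
    fix h assume "h \<in> S"
    then show "c powr (1 / p) \<le> Lp_norm_on P p R (\<lambda>x. f x - h x)"
      unfolding Lp_norm_on_eq using assms False by (intro powr_mono2) auto
  qed
  then have "(c powr (1 / p)) powr p \<le> approx_error P S p f R powr p"
    using assms(1) by (intro powr_mono2) auto
  then show ?thesis
    using assms(1) False by (simp add: powr_powr)
qed

lemma approx_error_triangle:
  assumes "p > 0" "\<eta> > 0" "R \<in> sets P" "in_Lp P p f" "in_Lp P p g"
    and S: "S \<noteq> {}" "\<And>h. h \<in> S \<Longrightarrow> in_Lp P p h"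
  shows "approx_error P S p f R powr p \<le> (1 + \<eta>) powr p * approx_error P S p g R powr p
    + (1 + 1 / \<eta>) powr p * Lp_energy P p R (\<lambda>x. f x - g x)"
proof -
  let ?K = "(1 + \<eta>) powr p" and ?D = "(1 + 1 / \<eta>) powr p * Lp_energy P p R (\<lambda>x. f x - g x)"
  have K: "?K > 0"
    using assms(2) by simp
  have "(approx_error P S p f R powr p - ?D) / ?K \<le> approx_error P S p g R powr p"
  proof (rule le_approx_error_powr [OF assms(1) S(1)])
    fix h assume h: "h \<in> S"
    have "approx_error P S p f R powr p \<le> ?K * Lp_energy P p R (\<lambda>x. g x - h x) + ?D"
      using approx_error_powr_le [OF assms(1) h, of P f R]
        Lp_energy_triangle [OF assms(1-5) S(2) [OF h]] by linarith
    then show "(approx_error P S p f R powr p - ?D) / ?K \<le> Lp_energy P p R (\<lambda>x. g x - h x)"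
      using K by (simp add: divide_le_eq mult.commute)
  qed
  then show ?thesis
    using K by (simp add: divide_le_eq mult.commute)
qed

text \<open>
  The error is continuous along a sequence converging in \<open>L\<^sup>p\<close>. For \<open>p < 1\<close> the triangle inequality
  of the norm fails, so the two halves of the limit come from \<open>approx_error_triangle\<close> instead,
  where \<open>\<eta>\<close> is fixed first, small enough for its factor to preserve a strict inequality, and
  only then the index of the sequence tends to infinity.
\<close>

lemma approx_error_tendsto:
  assumes p: "p > 0" and R: "R \<in> sets P" and f: "in_Lp P p f" and g: "\<And>n. in_Lp P p (g n)"
    and S: "S \<noteq> {}" "\<And>h. h \<in> S \<Longrightarrow> in_Lp P p h"
    and lim: "(\<lambda>n::nat. Lp_energy P p R (\<lambda>x. g n x - f x)) \<longlonglongrightarrow> 0"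
  shows "(\<lambda>n. approx_error P S p (g n) R) \<longlonglongrightarrow> approx_error P S p f R"
proof -
  let ?X = "\<lambda>n. approx_error P S p (g n) R powr p" and ?x = "approx_error P S p f R powr p"
  let ?e = "\<lambda>n. Lp_energy P p R (\<lambda>x. g n x - f x)"
  have small: "\<exists>\<eta>>0. (1 + \<eta>) powr p * u < v" if "u < v" for u v :: real
  proof -
    have "((\<lambda>\<eta>. (1 + \<eta>) powr p * u) \<longlongrightarrow> (1 + 0) powr p * u) (at_right 0)"
      by (intro tendsto_intros) auto
    then have "\<forall>\<^sub>F \<eta> in at_right 0. (1 + \<eta>) powr p * u < v"
      using that by (intro order_tendstoD) auto
    then have "\<forall>\<^sub>F \<eta> in at_right (0::real). 0 < \<eta> \<and> (1 + \<eta>) powr p * u < v"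
      by (rule eventually_conj [OF eventually_at_right_less])
    then show ?thesis
      using eventually_happens' [OF trivial_limit_at_right_real] by blast
  qed
  have upper: "?X n \<le> (1 + \<eta>) powr p * ?x + (1 + 1 / \<eta>) powr p * ?e n" if "\<eta> > 0" for n \<eta>
    by (rule approx_error_triangle [OF p that R g f S])
  have lower: "?x \<le> (1 + \<eta>) powr p * ?X n + (1 + 1 / \<eta>) powr p * ?e n" if "\<eta> > 0" for n \<eta>
    using approx_error_triangle [OF p that R f g S] by (simp add: Lp_energy_minus_commute [of P p R f])
  have "?X \<longlonglongrightarrow> ?x"
  proof (rule order_tendstoI)
    fix v assume "?x < v"
    then obtain \<eta> where \<eta>: "\<eta> > 0" "(1 + \<eta>) powr p * ?x < v"
      using small by blast
    have "(\<lambda>n. (1 + \<eta>) powr p * ?x + (1 + 1 / \<eta>) powr p * ?e n)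
        \<longlonglongrightarrow> (1 + \<eta>) powr p * ?x + (1 + 1 / \<eta>) powr p * 0"
      by (intro tendsto_intros lim)
    then have "\<forall>\<^sub>F n in sequentially. (1 + \<eta>) powr p * ?x + (1 + 1 / \<eta>) powr p * ?e n < v"
      using \<eta>(2) by (intro order_tendstoD) auto
    then show "\<forall>\<^sub>F n in sequentially. ?X n < v"
      by eventually_elim (use upper [OF \<eta>(1)] in \<open>rule le_less_trans\<close>)
  next
    fix u assume "u < ?x"
    then obtain \<eta> where \<eta>: "\<eta> > 0" "(1 + \<eta>) powr p * u < ?x"
      using small by blast
    have "(\<lambda>n. ?x - (1 + 1 / \<eta>) powr p * ?e n) \<longlonglongrightarrow> ?x - (1 + 1 / \<eta>) powr p * 0"
      by (intro tendsto_intros lim)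
    then have "\<forall>\<^sub>F n in sequentially. (1 + \<eta>) powr p * u < ?x - (1 + 1 / \<eta>) powr p * ?e n"
      using \<eta>(2) by (intro order_tendstoD) auto
    then show "\<forall>\<^sub>F n in sequentially. u < ?X n"
    proof eventually_elim
      case (elim n)
      then have "(1 + \<eta>) powr p * u < (1 + \<eta>) powr p * ?X n"
        using lower [OF \<eta>(1), of n] by linarith
      then show ?case
        using \<eta>(1) by (simp add: mult_less_cancel_left_pos)
    qed
  qed
  then have "(\<lambda>n. ?X n powr (1 / p)) \<longlonglongrightarrow> ?x powr (1 / p)"
    by (rule tendsto_powr' [OF _ tendsto_const]) (use p in auto)
  then show ?thesis
    using p approx_error_nonneg [OF S(1)] by (simp add: powr_powr)
qed

section \<open>Functions that are piecewise in the approximation space\<close>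

locale near_best_system = nary_filtered P \<nu> F + prob_space P
  for P :: "'a measure" and \<nu> :: nat and F :: "nat \<Rightarrow> 'a measure" +
  fixes S :: "('a \<Rightarrow> 'k::{real_normed_field, euclidean_space}) set"
    and p M :: real and \<phi> :: "('a \<Rightarrow> 'k) \<Rightarrow> 'a set \<Rightarrow> 'a \<Rightarrow> 'k"
  assumes subspace_S: "module.subspace fscale S"
    and bounded_S: "\<And>h. h \<in> S \<Longrightarrow> h \<in> borel_measurable P \<and> bounded (h ` space P)"
    and p_pos: "p > 0"
    and M_ge_1: "M \<ge> 1"
    and near_best: "\<And>f A. f \<in> LpS P F S p \<Longrightarrow> A \<in> all_atoms F \<Longrightarrow> near_best P S p M A f (\<phi> f A)"
begin

sublocale fspace: vector_space "fscale :: 'k \<Rightarrow> ('a \<Rightarrow> 'k) \<Rightarrow> 'a \<Rightarrow> 'k"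
  by (rule vector_space_fscale)

lemma S_nonempty: "S \<noteq> {}"
  using fspace.subspace_0 [OF subspace_S] by auto

lemma S_in_Lp: "h \<in> S \<Longrightarrow> in_Lp P p h"
  using bounded_S p_pos by (auto intro: in_Lp_bounded)

lemma LpS_in_Lp: "f \<in> LpS P F S p \<Longrightarrow> in_Lp P p f"
  by (simp add: LpS_def)

definition piecewise_S :: "nat \<Rightarrow> ('a \<Rightarrow> 'k) \<Rightarrow> bool" where
  "piecewise_S \<mu> g \<longleftrightarrow> (\<forall>C\<in>atoms_at F \<mu>. \<exists>h\<in>S. \<forall>x\<in>C. g x = h x)"

lemma piecewise_S_add:
  assumes "piecewise_S \<mu> g" "piecewise_S \<mu> g'"
  shows "piecewise_S \<mu> (g + g')"
  unfolding piecewise_S_def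
proof
  fix C assume "C \<in> atoms_at F \<mu>"
  then obtain h h' where "h \<in> S" "h' \<in> S" "\<forall>x\<in>C. g x = h x" "\<forall>x\<in>C. g' x = h' x"
    using assms unfolding piecewise_S_def by blast
  then show "\<exists>h\<in>S. \<forall>x\<in>C. (g + g') x = h x"
    using fspace.subspace_add [OF subspace_S] by (intro bexI [of _ "h + h'"]) auto
qed

lemma piecewise_S_scale:
  assumes "piecewise_S \<mu> g"
  shows "piecewise_S \<mu> (fscale c g)"
  unfolding piecewise_S_def
proof
  fix C assume "C \<in> atoms_at F \<mu>"
  then obtain h where "h \<in> S" "\<forall>x\<in>C. g x = h x"
    using assms unfolding piecewise_S_def by blast
  then show "\<exists>h\<in>S. \<forall>x\<in>C. fscale c g x = h x"
    using fspace.subspace_scale [OF subspace_S] by (intro bexI [of _ "fscale c h"]) (auto simp: fscale_def)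
qed

lemma piecewise_S_restr:
  assumes "h \<in> S" "A \<in> sets (F \<mu>)"
  shows "piecewise_S \<mu> (restr A h)"
  unfolding piecewise_S_def
proof
  fix C assume C: "C \<in> atoms_at F \<mu>"
  show "\<exists>h'\<in>S. \<forall>x\<in>C. restr A h x = h' x"
  proof (cases "C \<inter> A = {}")
    case True
    then show ?thesis
      using fspace.subspace_0 [OF subspace_S] by (intro bexI [of _ 0]) (auto simp: restr_def indicator_def)
  next
    case False
    then show ?thesis
      using atom_subset_of_meets [OF C assms(2)] assms(1)
      by (intro bexI [of _ h]) (auto simp: restr_def indicator_def)
  qed
qed

lemma S_piecewise_S: "h \<in> S \<Longrightarrow> piecewise_S \<mu> h"
  by (auto simp: piecewise_S_def)

text \<open>
  A linear combination involves finitely many atoms only, all of which are measurable from some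
  level on.
\<close>

lemma span_eventually_piecewise_S:
  assumes "g \<in> module.span fscale {restr A h | h A. h \<in> S \<and> A \<in> all_atoms F}"
  shows "in_Lp P p g \<and> (\<forall>\<^sub>F \<mu> in sequentially. piecewise_S \<mu> g)"
  using assms
proof (induction rule: fspace.span_induct_alt)
  case base
  show ?case
    using fspace.subspace_0 [OF subspace_S]
    by (intro conjI always_eventually allI S_in_Lp S_piecewise_S)
next
  case (step c x y)
  then obtain A h where x: "x = restr A h" "h \<in> S" "A \<in> all_atoms F"
    by blast
  then obtain n where n: "A \<in> sets (F n)"
    using atoms_at_sets unfolding all_atoms_def by blast
  have "piecewise_S \<mu> x" if "\<mu> \<ge> n" for \<mu>
    using piecewise_S_restr x(1,2) n sets_F_mono [OF that] by blast
  then have "\<forall>\<^sub>F \<mu> in sequentially. piecewise_S \<mu> x"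
    by (auto simp: eventually_sequentially)
  moreover have "\<forall>\<^sub>F \<mu> in sequentially. piecewise_S \<mu> y"
    using step.IH by blast
  ultimately have "\<forall>\<^sub>F \<mu> in sequentially. piecewise_S \<mu> (fscale c x + y)"
    by eventually_elim (intro piecewise_S_add piecewise_S_scale)
  moreover have "in_Lp P p x"
    unfolding x(1) by (intro in_Lp_restr S_in_Lp all_atoms_sets x)
  then have "in_Lp P p (fscale c x + y)"
    using in_Lp_add [OF p_pos in_Lp_cmult [of P p x c]] step.IH by (simp add: fscale_def plus_fun_def)
  ultimately show ?case by blast
qed

section \<open>The operators \<open>W\<^sub>\<mu>\<close>\<close>

lemma approximant_in_S: "f \<in> LpS P F S p \<Longrightarrow> A \<in> all_atoms F \<Longrightarrow> \<phi> f A \<in> S"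
  using near_best by (simp add: near_best_def)

lemma W_op_on_atom:
  assumes "C \<in> atoms_at F \<mu>" "x \<in> C"
  shows "W_op F \<phi> \<mu> f x = \<phi> f C x"
proof -
  have "W_op F \<phi> \<mu> f x = (\<Sum>A\<in>{C}. restr A (\<phi> f A) x)"
    unfolding W_op_def
  proof (rule sum.mono_neutral_right [OF finite_atoms_at])
    show "\<forall>A\<in>atoms_at F \<mu> - {C}. restr A (\<phi> f A) x = 0"
      using atoms_at_eq_of_meets [OF _ assms(1)] assms(2) by (auto simp: restr_def indicator_def)
  qed (use assms in auto)
  then show ?thesis
    using assms(2) by (simp add: restr_def)
qed

lemma W_op_in_Lp:
  assumes "f \<in> LpS P F S p"
  shows "in_Lp P p (W_op F \<phi> \<mu> f)"
proof -
  have "in_Lp P p (\<lambda>x. \<Sum>A\<in>atoms_at F \<mu>. restr A (\<phi> f A) x)"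
  proof (rule in_Lp_sum [OF p_pos finite_atoms_at])
    fix A assume "A \<in> atoms_at F \<mu>"
    then have "A \<in> all_atoms F"
      by (auto simp: all_atoms_def)
    then show "in_Lp P p (restr A (\<phi> f A))"
      by (intro in_Lp_restr S_in_Lp approximant_in_S assms all_atoms_sets)
  qed
  then show ?thesis
    by (simp add: W_op_def)
qed

text \<open>
  The near-best property on single atoms extends to unions of atoms of level \<open>\<mu>\<close> by additivity of
  the energy, and on each of these atoms the competitor may be another element of \<open>S\<close>.
\<close>

lemma W_op_energy_le:
  assumes f: "f \<in> LpS P F S p" and g: "in_Lp P p g" "piecewise_S \<mu> g" and X: "X \<in> sets (F \<mu>)"
  shows "Lp_energy P p X (\<lambda>x. W_op F \<phi> \<mu> f x - g x) \<le> M powr p * Lp_energy P p X (\<lambda>x. f x - g x)"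
proof -
  let ?\<C> = "{C \<in> atoms_at F \<mu>. C \<subseteq> X}"
  have fin: "finite ?\<C>"
    using finite_atoms_at [of \<mu>] by simp
  have disj: "disjoint ?\<C>"
    using atoms_at_eq_of_meets by (auto simp: pairwise_def disjnt_def)
  have sub: "?\<C> \<subseteq> sets P"
    using atoms_at_sets sets_F_subset by blast
  have local: "Lp_energy P p C (\<lambda>x. W_op F \<phi> \<mu> f x - g x) \<le> M powr p * Lp_energy P p C (\<lambda>x. f x - g x)"
    if C: "C \<in> atoms_at F \<mu>" for C
  proof -
    obtain h where h: "h \<in> S" "\<forall>x\<in>C. g x = h x"
      using g(2) C unfolding piecewise_S_def by blast
    have "C \<in> all_atoms F"
      using C by (auto simp: all_atoms_def)
    then have "Lp_norm_on P p C (\<lambda>x. \<phi> f C x - h x) \<le> M * Lp_norm_on P p C (\<lambda>x. f x - h x)"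
      using near_best [OF f] h(1) by (simp add: near_best_def)
    then have "Lp_norm_on P p C (\<lambda>x. \<phi> f C x - h x) powr p
        \<le> (M * Lp_norm_on P p C (\<lambda>x. f x - h x)) powr p"
      using p_pos by (intro powr_mono2) (auto simp: Lp_norm_on_nonneg)
    then have "Lp_energy P p C (\<lambda>x. \<phi> f C x - h x) \<le> M powr p * Lp_energy P p C (\<lambda>x. f x - h x)"
      using M_ge_1 p_pos by (simp add: powr_mult Lp_norm_on_nonneg Lp_norm_on_powr)
    moreover have "Lp_energy P p C (\<lambda>x. W_op F \<phi> \<mu> f x - g x) = Lp_energy P p C (\<lambda>x. \<phi> f C x - h x)"
      by (rule Lp_energy_cong) (use W_op_on_atom [OF C] h(2) in auto)
    moreover have "Lp_energy P p C (\<lambda>x. f x - g x) = Lp_energy P p C (\<lambda>x. f x - h x)"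
      by (rule Lp_energy_cong) (use h(2) in auto)
    ultimately show ?thesis by simp
  qed
  have split: "Lp_energy P p X u = (\<Sum>C\<in>?\<C>. Lp_energy P p C u)" if "in_Lp P p u" for u :: "'a \<Rightarrow> 'k"
    using Lp_energy_finite_Union [OF that fin disj sub] sets_F_eq_Union_atoms [OF X] by simp
  show ?thesis
    unfolding split [OF in_Lp_diff [OF p_pos W_op_in_Lp [OF f] g(1)]]
      split [OF in_Lp_diff [OF p_pos LpS_in_Lp [OF f] g(1)]] sum_distrib_left
    by (rule sum_mono) (use local in blast)
qed

text \<open>
  Approximate \<open>f\<close> by a linear combination \<open>g\<close>; as soon as \<open>g\<close> is piecewise in \<open>S\<close> at level \<open>\<mu>\<close>,
  both \<open>f\<close> and \<open>W\<^sub>\<mu> f\<close> are close to \<open>g\<close>.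
\<close>

lemma W_op_energy_tendsto:
  assumes f: "f \<in> LpS P F S p"
  shows "(\<lambda>\<mu>. Lp_energy P p (space P) (\<lambda>x. W_op F \<phi> \<mu> f x - f x)) \<longlonglongrightarrow> 0"
proof (rule LIMSEQ_I)
  fix \<epsilon> :: real assume \<epsilon>: "\<epsilon> > 0"
  define K where "K = 2 powr p * (M powr p + 1)"
  have K: "K > 0"
    unfolding K_def by (intro mult_pos_pos add_nonneg_pos) auto
  let ?\<delta> = "(\<epsilon> / K) powr (1 / p)"
  have "?\<delta> > 0"
    using \<epsilon> K by simp
  then obtain g where g: "g \<in> module.span fscale {restr A h | h A. h \<in> S \<and> A \<in> all_atoms F}"
      "Lp_norm_on P p (space P) (\<lambda>x. f x - g x) < ?\<delta>"
    using f unfolding LpS_def by blast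
  let ?e = "Lp_energy P p (space P) (\<lambda>x. f x - g x)"
  have "Lp_norm_on P p (space P) (\<lambda>x. f x - g x) powr p < ?\<delta> powr p"
    using g(2) p_pos by (intro powr_less_mono2) (auto simp: Lp_norm_on_nonneg)
  then have e: "?e < \<epsilon> / K"
    using \<epsilon> K p_pos by (simp add: Lp_norm_on_powr powr_powr)
  have g_Lp: "in_Lp P p g" and ev: "\<forall>\<^sub>F \<mu> in sequentially. piecewise_S \<mu> g"
    using span_eventually_piecewise_S [OF g(1)] by auto
  have "\<forall>\<^sub>F \<mu> in sequentially. norm (Lp_energy P p (space P) (\<lambda>x. W_op F \<phi> \<mu> f x - f x) - 0) < \<epsilon>"
    using ev
  proof eventually_elim
    case (elim \<mu>)
    have X: "space P \<in> sets (F \<mu>)"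
      using sets.top [of "F \<mu>"] by simp
    have "Lp_energy P p (space P) (\<lambda>x. W_op F \<phi> \<mu> f x - f x)
        \<le> 2 powr p * Lp_energy P p (space P) (\<lambda>x. g x - f x)
          + 2 powr p * Lp_energy P p (space P) (\<lambda>x. W_op F \<phi> \<mu> f x - g x)"
      using Lp_energy_triangle [OF p_pos, of 1 "space P" P "W_op F \<phi> \<mu> f" g f]
        W_op_in_Lp [OF f] g_Lp LpS_in_Lp [OF f] by simp
    also have "\<dots> \<le> 2 powr p * ?e + 2 powr p * (M powr p * ?e)"
      using W_op_energy_le [OF f g_Lp elim X] Lp_energy_minus_commute [of P p "space P" g f]
      by (intro add_mono mult_left_mono) auto
    also have "\<dots> = K * ?e"
      by (simp add: K_def algebra_simps)
    also have "\<dots> < \<epsilon>"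
      using e K by (simp add: less_divide_eq mult.commute)
    finally show ?case
      by (simp add: Lp_energy_nonneg)
  qed
  then show "\<exists>n. \<forall>\<mu>\<ge>n. norm (Lp_energy P p (space P) (\<lambda>x. W_op F \<phi> \<mu> f x - f x) - 0) < \<epsilon>"
    by (simp add: eventually_sequentially)
qed

lemma W_op_Lp_norm_tendsto:
  assumes "f \<in> LpS P F S p"
  shows "(\<lambda>\<mu>. Lp_norm_on P p (space P) (\<lambda>x. W_op F \<phi> \<mu> f x - f x)) \<longlonglongrightarrow> 0"
proof -
  have "(\<lambda>\<mu>. Lp_energy P p (space P) (\<lambda>x. W_op F \<phi> \<mu> f x - f x) powr (1 / p)) \<longlonglongrightarrow> 0 powr (1 / p)"
    using p_pos by (intro tendsto_powr' W_op_energy_tendsto [OF assms]) (auto simp: Lp_energy_nonneg)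
  then show ?thesis
    by (simp add: Lp_norm_on_eq)
qed

section \<open>The variation of \<open>W\<^sub>\<mu> f\<close>\<close>

lemma approx_error_W_op_eq_0:
  assumes f: "f \<in> LpS P F S p" and C: "C \<in> atoms_at F \<mu>" and "R \<subseteq> C"
  shows "approx_error P S p (W_op F \<phi> \<mu> f) R = 0"
proof -
  have "C \<in> all_atoms F"
    using C by (auto simp: all_atoms_def)
  then have "approx_error P S p (W_op F \<phi> \<mu> f) R powr p
      \<le> Lp_energy P p R (\<lambda>x. W_op F \<phi> \<mu> f x - \<phi> f C x)"
    using p_pos f by (intro approx_error_powr_le approximant_in_S)
  also have "\<dots> = Lp_energy P p R (\<lambda>x. 0 :: 'k)"
    by (rule Lp_energy_cong) (use W_op_on_atom [OF C] assms(3) in auto)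
  also have "\<dots> = 0"
    using p_pos by (simp add: Lp_energy_def set_lebesgue_integral_def)
  finally show ?thesis
    by simp
qed

lemma approx_error_W_op_le:
  assumes f: "f \<in> LpS P F S p" and R: "R \<in> sets P"
  shows "approx_error P S p (W_op F \<phi> \<mu> f) R \<le> M * approx_error P S p f (saturation \<mu> R)"
proof -
  let ?E = "approx_error P S p (W_op F \<phi> \<mu> f) R" and ?E' = "approx_error P S p f (saturation \<mu> R)"
  have sat: "saturation \<mu> R \<in> sets P" "R \<subseteq> saturation \<mu> R"
    using saturation_sets [of \<mu> R] sets_F_subset subset_saturation sets.sets_into_space [OF R] by auto
  have Mp: "M powr p > 0"
    using M_ge_1 by simp
  have "?E powr p / M powr p \<le> ?E' powr p"
  proof (rule le_approx_error_powr [OF p_pos S_nonempty])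
    fix h assume h: "h \<in> S"
    have "?E powr p \<le> Lp_energy P p R (\<lambda>x. W_op F \<phi> \<mu> f x - h x)"
      by (rule approx_error_powr_le [OF p_pos h])
    also have "\<dots> \<le> Lp_energy P p (saturation \<mu> R) (\<lambda>x. W_op F \<phi> \<mu> f x - h x)"
      using sat R by (intro Lp_energy_subset_mono in_Lp_diff p_pos W_op_in_Lp f S_in_Lp h) auto
    also have "\<dots> \<le> M powr p * Lp_energy P p (saturation \<mu> R) (\<lambda>x. f x - h x)"
      by (rule W_op_energy_le [OF f S_in_Lp [OF h] S_piecewise_S [OF h] saturation_sets])
    finally show "?E powr p / M powr p \<le> Lp_energy P p (saturation \<mu> R) (\<lambda>x. f x - h x)"
      using Mp by (simp add: divide_le_eq mult.commute)
  qed
  then have "?E powr p \<le> (M * ?E') powr p"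
    using Mp M_ge_1 approx_error_nonneg [OF S_nonempty] by (simp add: powr_mult divide_le_eq mult.commute)
  then show ?thesis
    using powr_less_mono2 [of p "M * ?E'" ?E] p_pos M_ge_1 approx_error_nonneg [OF S_nonempty, of P p f]
    by fastforce
qed

text \<open>
  In a disjoint collection, the pieces inside single atoms of level \<open>\<mu>\<close> contribute nothing to the
  variation of \<open>W\<^sub>\<mu> f\<close>. The others may be replaced by their saturations, which again form a disjoint
  collection of atoms and rings, at the cost of a factor \<open>M\<close> in each term.
\<close>

lemma variation_W_op_le:
  assumes f: "f \<in> LpS P F S p" and \<sigma>: "\<sigma> > 0"
  shows "variation P F S \<sigma> p (W_op F \<phi> \<mu> f) \<le> ennreal M * variation P F S \<sigma> p f"
  unfolding variation_def [of P F S \<sigma> p "W_op F \<phi> \<mu> f"]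
proof (rule SUP_least)
  fix \<R> assume "\<R> \<in> {\<R>. finite \<R> \<and> \<R> \<subseteq> all_atoms F \<union> rings F \<and> disjoint \<R>}"
  then have \<R>: "finite \<R>" "\<R> \<subseteq> all_atoms F \<union> rings F" "disjoint \<R>"
    by auto
  let ?E = "approx_error P S p"
  define \<Q> where "\<Q> = {R \<in> \<R>. \<forall>C\<in>atoms_at F \<mu>. \<not> R \<subseteq> C}"
  let ?\<R>' = "saturation \<mu> ` \<Q>"
  have \<Q>: "finite \<Q>" "\<Q> \<subseteq> all_atoms F \<union> rings F"
    using \<R> by (auto simp: \<Q>_def)
  have disj: "saturation \<mu> R \<inter> saturation \<mu> R' = {}" if "R \<in> \<Q>" "R' \<in> \<Q>" "R \<noteq> R'" for R R'
  proof (rule saturation_disjoint)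
    show "R \<inter> R' = {}"
      using that \<R>(3) by (auto simp: \<Q>_def pairwise_def disjnt_def)
  qed (use that \<Q>(2) in \<open>auto simp: \<Q>_def\<close>)
  have sat: "saturation \<mu> R \<in> all_atoms F \<union> rings F" if "R \<in> \<Q>" for R
    using that \<Q>(2) by (intro saturation_atom_or_ring) (auto simp: \<Q>_def)
  have inj: "inj_on (saturation \<mu>) \<Q>"
    by (rule inj_onI) (metis disj sat atom_or_ring_nonempty inf.idem)
  have "(\<Sum>R\<in>\<R>. ?E (W_op F \<phi> \<mu> f) R powr \<sigma>) = (\<Sum>R\<in>\<Q>. ?E (W_op F \<phi> \<mu> f) R powr \<sigma>)"
    by (rule sum.mono_neutral_right [OF \<R>(1)]) (auto simp: \<Q>_def approx_error_W_op_eq_0 [OF f])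
  also have "\<dots> \<le> (\<Sum>R\<in>\<Q>. (M * ?E f (saturation \<mu> R)) powr \<sigma>)"
    using \<sigma> \<Q>(2)
    by (intro sum_mono powr_mono2 approx_error_W_op_le [OF f] atom_or_ring_sets)
      (auto simp: approx_error_nonneg [OF S_nonempty])
  also have "\<dots> = M powr \<sigma> * (\<Sum>R\<in>?\<R>'. ?E f R powr \<sigma>)"
    using M_ge_1 inj
    by (simp add: powr_mult approx_error_nonneg [OF S_nonempty] sum_distrib_left sum.reindex)
  finally have "(\<Sum>R\<in>\<R>. ?E (W_op F \<phi> \<mu> f) R powr \<sigma>) powr (1 / \<sigma>)
      \<le> (M powr \<sigma> * (\<Sum>R\<in>?\<R>'. ?E f R powr \<sigma>)) powr (1 / \<sigma>)"
    using \<sigma> by (intro powr_mono2) (auto intro: sum_nonneg)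
  also have "\<dots> = M * (\<Sum>R\<in>?\<R>'. ?E f R powr \<sigma>) powr (1 / \<sigma>)"
    using \<sigma> M_ge_1 by (simp add: powr_mult sum_nonneg powr_powr)
  finally have "ennreal ((\<Sum>R\<in>\<R>. ?E (W_op F \<phi> \<mu> f) R powr \<sigma>) powr (1 / \<sigma>))
      \<le> ennreal M * ennreal ((\<Sum>R\<in>?\<R>'. ?E f R powr \<sigma>) powr (1 / \<sigma>))"
    using M_ge_1 by (subst ennreal_mult [symmetric]) (auto intro: ennreal_leI)
  also have "ennreal ((\<Sum>R\<in>?\<R>'. ?E f R powr \<sigma>) powr (1 / \<sigma>)) \<le> variation P F S \<sigma> p f"
    unfolding variation_def
  proof (rule SUP_upper, intro CollectI conjI)
    show "disjoint ?\<R>'"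
      using disj by (auto simp: pairwise_def disjnt_def)
    show "?\<R>' \<subseteq> all_atoms F \<union> rings F"
      using sat by blast
  qed (simp add: \<Q>(1))
  finally show "ennreal ((\<Sum>R\<in>\<R>. ?E (W_op F \<phi> \<mu> f) R powr \<sigma>) powr (1 / \<sigma>))
      \<le> ennreal M * variation P F S \<sigma> p f"
    by (simp add: mult_left_mono)
qed

text \<open>
  For a fixed finite collection, the sum defining the variation is continuous under \<open>L\<^sup>p\<close>
  convergence, so the variation, as a supremum of such sums, is lower semicontinuous.
\<close>

lemma variation_le_liminf:
  assumes f: "f \<in> LpS P F S p" and \<sigma>: "\<sigma> > 0"
  shows "variation P F S \<sigma> p f \<le> liminf (\<lambda>\<mu>. variation P F S \<sigma> p (W_op F \<phi> \<mu> f))"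
  unfolding variation_def [of P F S \<sigma> p f]
proof (rule SUP_least)
  fix \<R> assume \<R>: "\<R> \<in> {\<R>. finite \<R> \<and> \<R> \<subseteq> all_atoms F \<union> rings F \<and> disjoint \<R>}"
  let ?s = "\<lambda>g. ennreal ((\<Sum>R\<in>\<R>. approx_error P S p g R powr \<sigma>) powr (1 / \<sigma>))"
  have "(\<lambda>\<mu>. approx_error P S p (W_op F \<phi> \<mu> f) R) \<longlonglongrightarrow> approx_error P S p f R" if "R \<in> \<R>" for R
  proof (rule approx_error_tendsto [OF p_pos _ LpS_in_Lp [OF f] W_op_in_Lp [OF f] S_nonempty S_in_Lp])
    show R: "R \<in> sets P"
      using that \<R> atom_or_ring_sets by blast
    show "(\<lambda>\<mu>. Lp_energy P p R (\<lambda>x. W_op F \<phi> \<mu> f x - f x)) \<longlonglongrightarrow> 0"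
    proof (rule tendsto_sandwich [OF _ _ tendsto_const W_op_energy_tendsto [OF f]])
      show "\<forall>\<^sub>F \<mu> in sequentially. Lp_energy P p R (\<lambda>x. W_op F \<phi> \<mu> f x - f x)
          \<le> Lp_energy P p (space P) (\<lambda>x. W_op F \<phi> \<mu> f x - f x)"
        using R sets.sets_into_space [OF R]
        by (intro always_eventually allI Lp_energy_subset_mono in_Lp_diff p_pos W_op_in_Lp LpS_in_Lp f)
          auto
    qed (auto simp: Lp_energy_nonneg)
  qed
  then have "(\<lambda>\<mu>. ?s (W_op F \<phi> \<mu> f)) \<longlonglongrightarrow> ?s f"
    using \<sigma> by (intro tendsto_ennrealI tendsto_powr' tendsto_sum)
      (auto simp: approx_error_nonneg [OF S_nonempty] intro!: always_eventually sum_nonneg)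
  then have "?s f = liminf (\<lambda>\<mu>. ?s (W_op F \<phi> \<mu> f))"
    by (intro lim_imp_Liminf [symmetric]) auto
  also have "\<dots> \<le> liminf (\<lambda>\<mu>. variation P F S \<sigma> p (W_op F \<phi> \<mu> f))"
    by (intro Liminf_mono always_eventually allI) (unfold variation_def, rule SUP_upper, fact \<R>)
  finally show "?s f \<le> liminf (\<lambda>\<mu>. variation P F S \<sigma> p (W_op F \<phi> \<mu> f))" .
qed

end

theorem theorem3p9:
  fixes P :: "'a measure"
    and \<nu> :: nat
    and F :: "nat \<Rightarrow> 'a measure"
    and S :: "('a \<Rightarrow> 'k::{real_normed_field, euclidean_space}) set"
    and \<sigma> p M :: real
    and \<phi> :: "('a \<Rightarrow> 'k) \<Rightarrow> 'a set \<Rightarrow> 'a \<Rightarrow> 'k"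
  assumes "prob_space P"
    and "\<nu> \<ge> 2"
    and "nary_filtration P \<nu> F"
    and "admissible_space P F S"
    and "0 < \<sigma>" and "\<sigma> < p"
    and "M \<ge> 1"
    and "\<And>f A. f \<in> LpS P F S p \<Longrightarrow> A \<in> all_atoms F \<Longrightarrow> near_best P S p M A f (\<phi> f A)"
  shows "\<forall>f\<in>LpS P F S p.
      (\<lambda>\<mu>. Lp_norm_on P p (space P) (\<lambda>x. W_op F \<phi> \<mu> f x - f x)) \<longlonglongrightarrow> 0 \<and>
      (let V = variation P F S \<sigma> p;
           a = V f;
           b = liminf (\<lambda>\<mu>. V (W_op F \<phi> \<mu> f));
           c = limsup (\<lambda>\<mu>. V (W_op F \<phi> \<mu> f));
           d = (SUP \<mu>. V (W_op F \<phi> \<mu> f));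
           e = ennreal M * V f
       in a \<le> b \<and> b \<le> c \<and> c \<le> d \<and> d \<le> e \<and>
          ((\<exists>v\<in>{a, b, c, d, e}. v = \<infinity>) \<longrightarrow> (\<forall>v\<in>{a, b, c, d, e}. v = \<infinity>)) \<and>
          ((\<exists>v\<in>{a, b, c, d, e}. v < \<infinity>) \<longrightarrow> (\<forall>v\<in>{a, b, c, d, e}. v < \<infinity>)))"
proof (rule ballI, rule conjI)
  have "p > 0"
    using assms(5,6) by simp
  interpret prob_space P by fact
  interpret near_best_system P \<nu> F S p M \<phi>
    using assms \<open>p > 0\<close>
    by unfold_locales (auto simp: admissible_space_def fin_dim_function_space_def)
  fix f assume f: "f \<in> LpS P F S p"
  show "(\<lambda>\<mu>. Lp_norm_on P p (space P) (\<lambda>x. W_op F \<phi> \<mu> f x - f x)) \<longlonglongrightarrow> 0"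
    by (rule W_op_Lp_norm_tendsto [OF f])
  define a where "a = variation P F S \<sigma> p f"
  define V where "V = (\<lambda>\<mu>. variation P F S \<sigma> p (W_op F \<phi> \<mu> f))"
  have chain: "a \<le> liminf V" "liminf V \<le> limsup V" "limsup V \<le> (SUP \<mu>. V \<mu>)" "(SUP \<mu>. V \<mu>) \<le> ennreal M * a"
  proof -
    show "a \<le> liminf V"
      unfolding a_def V_def by (rule variation_le_liminf [OF f assms(5)])
    show "liminf V \<le> limsup V"
      by (rule Liminf_le_Limsup) simp
    show "limsup V \<le> (SUP \<mu>. V \<mu>)"
      by (rule Limsup_bounded) (auto intro: always_eventually SUP_upper)
    show "(SUP \<mu>. V \<mu>) \<le> ennreal M * a"
      unfolding a_def V_def by (rule SUP_least) (rule variation_W_op_le [OF f assms(5)])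
  qed
  have top: "a = \<infinity>" if "ennreal M * a = \<infinity>"
    using that by (auto simp: ennreal_mult_eq_top_iff)
  define A where "A = {a, liminf V, limsup V, SUP \<mu>. V \<mu>, ennreal M * a}"
  have all_top: "v = \<infinity> \<longleftrightarrow> a = \<infinity>" if "v \<in> A" for v
  proof -
    have "a \<le> v" "v \<le> ennreal M * a"
      using that chain by (auto simp: A_def intro: order_trans)
    then show ?thesis
      using top by (auto simp: top_unique)
  qed
  have infinite: "(\<exists>v\<in>A. v = \<infinity>) \<longrightarrow> (\<forall>v\<in>A. v = \<infinity>)"
    using all_top by blast
  have finite: "(\<exists>v\<in>A. v < \<infinity>) \<longrightarrow> (\<forall>v\<in>A. v < \<infinity>)"
    using all_top by (metis infinity_ennreal_def less_top)
  show "let V = variation P F S \<sigma> p;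
           a = V f;
           b = liminf (\<lambda>\<mu>. V (W_op F \<phi> \<mu> f));
           c = limsup (\<lambda>\<mu>. V (W_op F \<phi> \<mu> f));
           d = (SUP \<mu>. V (W_op F \<phi> \<mu> f));
           e = ennreal M * V f
       in a \<le> b \<and> b \<le> c \<and> c \<le> d \<and> d \<le> e \<and>
          ((\<exists>v\<in>{a, b, c, d, e}. v = \<infinity>) \<longrightarrow> (\<forall>v\<in>{a, b, c, d, e}. v = \<infinity>)) \<and>
          ((\<exists>v\<in>{a, b, c, d, e}. v < \<infinity>) \<longrightarrow> (\<forall>v\<in>{a, b, c, d, e}. v < \<infinity>))"
    using chain infinite finite unfolding Let_def A_def a_def V_def by (intro conjI)
qed

end
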